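(* Let $k$ be an algebraically closed field, let $a_1,\dots,a_v$ ($v>0$) be positive integers with $\operatorname{GCD}(a_1,\dots,a_v)=1$, let $H=\langle a_1,\dots,a_v\rangle$ and assume $1\notin H$. Let $S=k[t]$, $R=k[H]=k[t^{a_1},\dots,t^{a_v}]\subseteq S$, and $P_0=(t^{a_1},\dots,t^{a_v})=tS\cap R$. Let $M$ be a maximal ideal of $R$. Then $\mu_R(M)=2$ if $M\ne P_0$, and $\mu_R(M)=\mu(H)$ if $M=P_0$.
   Context: $\langle a_1,\dots,a_v\rangle=\{\sum_{i=1}^v c_ia_i\mid 0\le c_i\in\mathbb Z\}$ is the numerical semigroup generated by the $a_i$. $\mu_R(M)$ is the minimal number of generators of the $R$-module $M$, and $\mu(H)$ is the minimal number of generators of the semigroup $H$. *)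

theory Defs
  imports
    "HOL-Algebra.Algebraic_Closure_Type"
    "HOL-Algebra.Generated_Rings"
    "HOL-Library.Extended_Nat"
begin

section \<open>Numerical semigroups\<close>

definition num_semigroup :: "(nat \<Rightarrow> nat) \<Rightarrow> nat \<Rightarrow> nat set" where
  "num_semigroup a v = {\<Sum>i=1..v. c i * a i | c :: nat \<Rightarrow> nat. True}"

text \<open>The infimum is taken in \<^typ>\<open>enat\<close>, so that it is \<^term>\<open>\<infinity>\<close> (and not a junk
  value) if there is no finite generating system; the same applies to \<open>module_mu\<close> below.\<close>

definition semigroup_mu :: "nat set \<Rightarrow> enat" where
  "semigroup_mu H = Inf {enat n | n. \<exists>b. H = num_semigroup b n}"

section \<open>Minimal number of generators of a module\<close>

definition module_mu :: "('a, 'c) ring_scheme \<Rightarrow> ('a, 'b, 'd) module_scheme \<Rightarrow> enat" where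
  "module_mu R M =
     Inf {enat (card B) | B. finite B \<and> B \<subseteq> carrier M \<and> \<Inter>{N. submodule N R M \<and> B \<subseteq> N} = carrier M}"

text \<open>An ideal \<open>I\<close> of \<open>R\<close> viewed as an \<open>R\<close>-module. The fields \<open>mult\<close> and \<open>one\<close> belong to the
  record type but play no role in the module structure.\<close>

definition ideal_module :: "('a, 'c) ring_scheme \<Rightarrow> 'a set \<Rightarrow> ('a, 'a) module" where
  "ideal_module R I =
     \<lparr>carrier = I, monoid.mult = monoid.mult R, one = one R, zero = zero R, add = add R, module.smult = monoid.mult R\<rparr>"

section \<open>Semigroup rings\<close>

text \<open>The ring \<open>k[H]\<close>, realised inside \<open>k[t]\<close> as the span of the monomials \<open>t\<^sup>h\<close> with \<open>h \<in> H\<close>.\<close>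

definition semigroup_ring :: "nat set \<Rightarrow> 'k::field poly ring" where
  "semigroup_ring H = ring_of_type_algebra\<lparr>carrier := {p. \<forall>n. poly.coeff p n \<noteq> 0 \<longrightarrow> n \<in> H}\<rparr>"

section \<open>Consistency of the definitions\<close>

lemma num_semigroup_zero: "0 \<in> num_semigroup a v"
  unfolding num_semigroup_def by (rule CollectI, rule exI[of _ "\<lambda>_. 0"]) simp

lemma num_semigroup_add:
  assumes "x \<in> num_semigroup a v" "y \<in> num_semigroup a v"
  shows "x + y \<in> num_semigroup a v"
proof -
  from assms obtain c d where "x = (\<Sum>i=1..v. c i * a i)" "y = (\<Sum>i=1..v. d i * a i)"
    unfolding num_semigroup_def by blast
  hence "x + y = (\<Sum>i=1..v. (c i + d i) * a i)"
    by (simp add: sum.distrib algebra_simps)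
  thus ?thesis unfolding num_semigroup_def
    by (intro CollectI exI[of _ "\<lambda>i. c i + d i"]) simp
qed

lemma num_semigroup_gen:
  assumes "i \<in> {1..v}"
  shows "a i \<in> num_semigroup a v"
proof -
  have "(\<Sum>j=1..v. (if j = i then 1 else 0) * a j) = (\<Sum>j\<in>{1..v}. if j = i then a j else 0)"
    by (rule sum.cong) auto
  also have "\<dots> = a i" using assms by (subst sum.delta) auto
  finally have "a i = (\<Sum>j=1..v. (if j = i then 1 else 0) * a j)" by simp
  thus ?thesis unfolding num_semigroup_def
    by (intro CollectI exI[of _ "\<lambda>j. if j = i then 1 else 0"]) simp
qed

lemma semigroup_ring_simps:
  "carrier (semigroup_ring H) = {p. \<forall>n. poly.coeff p n \<noteq> 0 \<longrightarrow> n \<in> H}"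
  "monoid.mult (semigroup_ring H) = (*)"
  "one (semigroup_ring H) = 1"
  "zero (semigroup_ring H) = 0"
  "add (semigroup_ring H) = (+)"
  by (auto simp: semigroup_ring_def ring_of_type_algebra_def fun_eq_iff)

lemma ring_of_type_algebra_a_inv: "a_inv (ring_of_type_algebra :: 'a::comm_ring_1 ring) p = - p"
proof -
  interpret cring "ring_of_type_algebra :: 'a ring" by (rule cring_from_type_algebra)
  show ?thesis
    by (rule minus_equality) (auto simp: ring_of_type_algebra_def)
qed

lemma semigroup_ring_subring:
  assumes zero: "0 \<in> H" and add: "\<And>x y. x \<in> H \<Longrightarrow> y \<in> H \<Longrightarrow> x + y \<in> H"
  shows "subring (carrier (semigroup_ring H)) (ring_of_type_algebra :: 'k::field poly ring)"
proof -
  interpret cring "ring_of_type_algebra :: 'k poly ring" by (rule cring_from_type_algebra)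
  show ?thesis
  proof (rule subringI, goal_cases)
    case (4 p q)
    hence p: "\<And>n. poly.coeff p n \<noteq> 0 \<Longrightarrow> n \<in> H" and q: "\<And>n. poly.coeff q n \<noteq> 0 \<Longrightarrow> n \<in> H"
      by (auto simp: semigroup_ring_simps)
    have "n \<in> H" if "poly.coeff (p * q) n \<noteq> 0" for n
    proof -
      from that obtain i where "i \<le> n" "poly.coeff p i * poly.coeff q (n - i) \<noteq> 0"
        unfolding coeff_mult by (metis (mono_tags, lifting) atMost_iff sum.not_neutral_contains_not_neutral)
      thus ?thesis using add[OF p q, of i "n - i"] by auto
    qed
    thus ?case by (auto simp: ring_of_type_algebra_def semigroup_ring_simps)
  next
    case (5 p q)
    have "n \<in> H" if "poly.coeff (p + q) n \<noteq> 0" for n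
      using that 5 by (cases "poly.coeff p n = 0") (auto simp: semigroup_ring_simps)
    thus ?case by (auto simp: ring_of_type_algebra_def semigroup_ring_simps)
  next
    case (3 p)
    thus ?case by (simp add: semigroup_ring_simps ring_of_type_algebra_a_inv)
  next
    case 2
    show ?case using assms(1) by (simp add: semigroup_ring_simps ring_of_type_algebra_def)
  qed (simp add: ring_of_type_algebra_def)
qed

lemma cring_semigroup_ring:
  assumes "0 \<in> H" "\<And>x y. x \<in> H \<Longrightarrow> y \<in> H \<Longrightarrow> x + y \<in> H"
  shows "cring (semigroup_ring H :: 'k::field poly ring)"
proof -
  interpret cring "ring_of_type_algebra :: 'k poly ring" by (rule cring_from_type_algebra)
  have eq: "semigroup_ring H = ring_of_type_algebra\<lparr>carrier := carrier (semigroup_ring H)\<rparr>"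
    by (simp add: semigroup_ring_def)
  show ?thesis
    using subcring_iff[of "carrier (semigroup_ring H)"] subcringI'[OF semigroup_ring_subring[OF assms]]
    by (subst eq) (simp add: ring_of_type_algebra_def)
qed

lemma cring_semigroup_ring':
  "cring (semigroup_ring (num_semigroup a v) :: 'k::field poly ring)"
  by (rule cring_semigroup_ring) (auto intro: num_semigroup_zero num_semigroup_add)

text \<open>\<open>k[H] = k[t\<^bsup>a\<^sub>1\<^esup>, \<dots>, t\<^bsup>a\<^sub>v\<^esup>]\<close>, the \<open>k\<close>-subalgebra of \<open>k[t]\<close> generated by these monomials.\<close>

lemma semigroup_ring_eq_generate_ring:
  "carrier (semigroup_ring (num_semigroup a v)) =
   generate_ring (ring_of_type_algebra :: 'k::field poly ring)
     (range (\<lambda>c. [:c:]) \<union> (\<lambda>i. monom 1 (a i)) ` {1..v})"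
   (is "?A = generate_ring ?S ?X")
proof
  interpret S: cring ?S by (rule cring_from_type_algebra)
  let ?G = "generate_ring ?S ?X"
  have G: "subring ?G ?S"
    by (rule S.generate_ring_is_subring) (auto simp: ring_of_type_algebra_def)
  have one: "1 \<in> ?G" and zero: "0 \<in> ?G"
    and add: "\<And>p q. p \<in> ?G \<Longrightarrow> q \<in> ?G \<Longrightarrow> p + q \<in> ?G"
    and mult: "\<And>p q. p \<in> ?G \<Longrightarrow> q \<in> ?G \<Longrightarrow> p * q \<in> ?G"
    using subringE(2,3,6,7)[OF G] by (simp_all add: ring_of_type_algebra_def)
  have pow: "p ^ n \<in> ?G" if "p \<in> ?G" for p n
    by (induction n) (use that one mult in auto)
  have mon: "monom 1 (\<Sum>i\<in>I. c i * a i) \<in> ?G" if "finite I" "I \<subseteq> {1..v}" for c I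
    using that
  proof (induction I)
    case empty
    thus ?case using one by (simp add: monom_0 flip: one_pCons)
  next
    case (insert i I)
    have "monom (1::'k) (a i) \<in> ?G" using insert by (intro generate_ring.incl) auto
    hence "monom 1 (a i) ^ c i * monom 1 (\<Sum>i\<in>I. c i * a i) \<in> ?G"
      using insert by (intro mult pow) auto
    thus ?case using insert by (simp add: monom_power mult_monom mult.commute)
  qed
  show "?A \<subseteq> ?G"
  proof
    fix p :: "'k poly" assume p: "p \<in> ?A"
    have "monom (poly.coeff p n) n \<in> ?G" for n
    proof (cases "poly.coeff p n = 0")
      case False
      hence "n \<in> num_semigroup a v" using p by (auto simp: semigroup_ring_simps)
      hence "monom 1 n \<in> ?G" using mon[of "{1..v}"] by (auto simp: num_semigroup_def)
      moreover have "[:poly.coeff p n:] \<in> ?G" by (intro generate_ring.incl) auto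
      ultimately have "[:poly.coeff p n:] * monom 1 n \<in> ?G" by (rule mult[rotated])
      thus ?thesis by (simp add: smult_monom)
    qed (use zero in auto)
    note * = this
    have "(\<Sum>n\<in>I. monom (poly.coeff p n) n) \<in> ?G" if "finite I" for I
      using that
    proof (induction I)
      case empty
      show ?case unfolding sum.empty by (rule zero)
    next
      case (insert n I)
      show ?case unfolding sum.insert[OF insert.hyps(1,2)] by (rule add[OF * insert.IH])
    qed
    from this[of "{..degree p}"] show "p \<in> ?G" by (simp add: poly_as_sum_of_monoms)
  qed
  show "?G \<subseteq> ?A"
  proof (rule S.generate_ring_min_subring1)
    show "?X \<subseteq> ?A"
      using num_semigroup_gen[of _ v a] num_semigroup_zero[of a v]
      by (auto simp: semigroup_ring_simps coeff_pCons split: nat.splits if_splits)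
    show "subring ?A ?S"
      by (intro semigroup_ring_subring num_semigroup_zero num_semigroup_add)
  qed (simp add: ring_of_type_algebra_def)
qed

text \<open>\<open>P\<^sub>0 = tS \<inter> R\<close>.\<close>

lemma genideal_monoms_eq:
  assumes "\<And>i. i \<in> {1..v} \<Longrightarrow> 0 < a i"
  shows "genideal (semigroup_ring (num_semigroup a v)) ((\<lambda>i. monom 1 (a i)) ` {1..v}) =
           cgenideal ring_of_type_algebra (monom (1::'k::field) 1)
             \<inter> carrier (semigroup_ring (num_semigroup a v))"
proof -
  let ?H = "num_semigroup a v"
  let ?R = "semigroup_ring ?H :: 'k poly ring"
  let ?X = "(\<lambda>i. monom (1::'k) (a i)) ` {1..v}"
  let ?I = "genideal ?R ?X"
  interpret R: cring ?R by (rule cring_semigroup_ring')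
  have tS: "cgenideal ring_of_type_algebra (monom (1::'k) 1) = {p. poly.coeff p 0 = 0}"
  proof -
    have "poly.coeff p 0 = 0 \<longleftrightarrow> (\<exists>q. p = q * monom 1 1)" for p :: "'k poly"
    proof
      assume "poly.coeff p 0 = 0"
      hence "p = pCons 0 (poly_shift 1 p)"
        by (intro poly_eqI) (auto simp: coeff_pCons coeff_poly_shift split: nat.splits)
      also have "\<dots> = poly_shift 1 p * monom 1 1" by (simp add: monom_Suc monom_0)
      finally show "\<exists>q. p = q * monom 1 1" by blast
    qed (auto simp: monom_Suc monom_0)
    thus ?thesis unfolding cgenideal_def by (auto simp: ring_of_type_algebra_def)
  qed
  have Xc: "?X \<subseteq> carrier ?R"
    by (auto simp: semigroup_ring_simps num_semigroup_gen split: if_splits)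
  interpret I: ideal "?I" ?R
    by (rule R.genideal_ideal[OF Xc])
  have XI: "?X \<subseteq> ?I"
    by (rule R.genideal_self[OF Xc])
  have a_inv: "a_inv ?R p = - p" if "p \<in> carrier ?R" for p
    using that by (intro R.minus_equality) (auto simp: semigroup_ring_simps)
  have ideal: "ideal {p \<in> carrier ?R. poly.coeff p 0 = 0} ?R"
  proof (rule idealI)
    show "ring ?R" by unfold_locales
    show "subgroup {p \<in> carrier ?R. poly.coeff p 0 = 0} (add_monoid ?R)"
      using R.add.group_axioms 
    proof (intro group.subgroupI, goal_cases)
      case (4 p)
      hence "a_inv ?R p \<in> carrier ?R" "a_inv ?R p = - p" using a_inv R.a_inv_closed by blast+
      with 4 show ?case by (simp add: a_inv_def)
    next
      case (5 p q)
      hence "add ?R p q \<in> carrier ?R" by (intro R.add.m_closed) auto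
      with 5 show ?case by (auto simp: semigroup_ring_simps(5))
    qed (auto simp: semigroup_ring_simps intro!: exI[of _ 0])
  next
    fix p q assume *: "p \<in> {p \<in> carrier ?R. poly.coeff p 0 = 0}" "q \<in> carrier ?R"
    hence "monoid.mult ?R q p \<in> carrier ?R" "monoid.mult ?R p q \<in> carrier ?R" by auto
    with * show "monoid.mult ?R q p \<in> {p \<in> carrier ?R. poly.coeff p 0 = 0}"
      "monoid.mult ?R p q \<in> {p \<in> carrier ?R. poly.coeff p 0 = 0}"
      by (auto simp: semigroup_ring_simps(2) coeff_mult)
  qed
  have "?I \<subseteq> {p \<in> carrier ?R. poly.coeff p 0 = 0}"
    by (rule R.genideal_minimal[OF ideal])
       (use Xc assms in \<open>auto dest!: subsetD\<close>)
  moreover have "{p \<in> carrier ?R. poly.coeff p 0 = 0} \<subseteq> ?I"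
  proof
    fix p assume p: "p \<in> {p \<in> carrier ?R. poly.coeff p 0 = 0}"
    have mult: "q * r \<in> ?I"
      if "r \<in> ?I" "q \<in> carrier ?R" for q r
      using I.I_l_closed[OF that] by (simp add: semigroup_ring_simps)
    have "monom (poly.coeff p n) n \<in> ?I" for n
    proof (cases "poly.coeff p n = 0")
      case True
      thus ?thesis using I.additive_subgroup_axioms additive_subgroup.zero_closed
        by (fastforce simp: semigroup_ring_simps)
    next
      case False
      with p have n: "n \<in> ?H" "n \<noteq> 0" by (auto simp: semigroup_ring_simps intro: gr0I)
      then obtain c where c: "n = (\<Sum>i=1..v. c i * a i)" by (auto simp: num_semigroup_def)
      with n obtain j where j: "j \<in> {1..v}" "c j * a j \<noteq> 0"
        by (metis (no_types, lifting) sum.neutral)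
      define d where "d = c(j := c j - 1)"
      have "n = c j * a j + (\<Sum>i\<in>{1..v}-{j}. c i * a i)"
        using c j by (simp add: sum.remove)
      also have "(\<Sum>i\<in>{1..v}-{j}. c i * a i) = (\<Sum>i\<in>{1..v}-{j}. d i * a i)"
        by (rule sum.cong) (auto simp: d_def)
      also have "c j * a j = a j + d j * a j"
        using j by (cases "c j") (auto simp: d_def)
      finally have eq: "n = (\<Sum>i=1..v. d i * a i) + a j"
        using j by (simp add: sum.remove)
      have "monom (poly.coeff p n) (\<Sum>i=1..v. d i * a i) * monom 1 (a j) \<in> ?I"
        by (rule mult) (use XI j in \<open>auto simp: semigroup_ring_simps num_semigroup_def\<close>)
      thus ?thesis using eq by (simp add: mult_monom)
    qed
    note * = this
    have "(\<Sum>n\<in>J. monom (poly.coeff p n) n) \<in> ?I" if "finite J" for J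
      using that
    proof (induction J)
      case empty
      show ?case using I.zero_closed by (simp add: semigroup_ring_simps)
    next
      case (insert n J)
      thus ?case using I.a_closed[of "monom (poly.coeff p n) n" "\<Sum>n\<in>J. monom (poly.coeff p n) n"] *
        by (simp add: semigroup_ring_simps)
    qed
    from this[of "{..degree p}"] show "p \<in> ?I"
      by (simp add: poly_as_sum_of_monoms)
  qed
  ultimately show ?thesis unfolding tS by auto
qed

lemma module_ideal_module:
  assumes "cring R" "ideal I R"
  shows "Module.module R (ideal_module R I)"
proof -
  interpret cring R by fact
  interpret I: ideal I R by fact
  show ?thesis
  proof (rule moduleI)
    show "abelian_group (ideal_module R I)"
    proof (rule abelian_groupI)
      fix x assume "x \<in> carrier (ideal_module R I)"
      thus "\<exists>y\<in>carrier (ideal_module R I). y \<oplus>\<^bsub>ideal_module R I\<^esub> x = \<zero>\<^bsub>ideal_module R I\<^esub>"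
        using I.a_inv_closed[of x] I.a_Hcarr[of x]
        by (intro bexI[of _ "\<ominus>\<^bsub>R\<^esub> x"]) (simp_all add: ideal_module_def l_neg)
    qed (auto simp: ideal_module_def a_ac I.a_Hcarr)
  qed (auto simp: ideal_module_def I.a_Hcarr I.I_l_closed l_distr r_distr m_assoc assms)
qed

text \<open>Generating an ideal as a module is the same as generating it as an ideal.\<close>

lemma submodule_ideal_module_iff:
  assumes "cring R" "ideal I R"
  shows "submodule N R (ideal_module R I) \<longleftrightarrow> ideal N R \<and> N \<subseteq> I"
proof -
  interpret cring R by fact
  interpret I: ideal I R by fact
  interpret M: Module.module R "ideal_module R I" by (rule module_ideal_module) fact+
  have inv: "\<ominus>\<^bsub>ideal_module R I\<^esub> x = \<ominus>\<^bsub>R\<^esub> x" if "x \<in> I" for x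
    using that I.a_inv_closed I.a_Hcarr
    by (intro M.minus_equality) (auto simp: ideal_module_def l_neg)
  show ?thesis
  proof
    assume *: "submodule N R (ideal_module R I)"
    note E = M.submoduleE[OF *]
    have NI: "N \<subseteq> I" using E(1) by (simp add: ideal_module_def)
    have "ideal N R"
    proof (rule idealI)
      show "ring R" by unfold_locales
      show "subgroup N (add_monoid R)"
      proof (rule add.subgroupI)
        show "N \<subseteq> carrier R" using NI I.a_subset by blast
        show "N \<noteq> {}" by (rule E(2))
        show "\<ominus>\<^bsub>R\<^esub> x \<in> N" if "x \<in> N" for x
          using E(3)[OF that] inv NI that by auto
        show "x \<oplus>\<^bsub>R\<^esub> y \<in> N" if "x \<in> N" "y \<in> N" for x y
          using E(5)[OF that] by (simp add: ideal_module_def)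
      qed
      show "x \<otimes>\<^bsub>R\<^esub> n \<in> N" if "n \<in> N" "x \<in> carrier R" for n x
        using E(4)[of x n] that by (simp add: ideal_module_def)
      thus "n \<otimes>\<^bsub>R\<^esub> x \<in> N" if "n \<in> N" "x \<in> carrier R" for n x
        using that NI I.a_Hcarr by (metis m_comm subsetD)
    qed
    with NI show "ideal N R \<and> N \<subseteq> I" by blast
  next
    assume *: "ideal N R \<and> N \<subseteq> I"
    then interpret N: ideal N R by blast
    show "submodule N R (ideal_module R I)"
    proof (rule M.submoduleI)
      show "N \<subseteq> carrier (ideal_module R I)" using * by (simp add: ideal_module_def)
      show "\<zero>\<^bsub>ideal_module R I\<^esub> \<in> N" by (simp add: ideal_module_def)
      show "\<ominus>\<^bsub>ideal_module R I\<^esub> x \<in> N" if "x \<in> N" for x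
        using that * inv[of x] N.a_inv_closed[of x] by auto
      show "x \<oplus>\<^bsub>ideal_module R I\<^esub> y \<in> N" if "x \<in> N" "y \<in> N" for x y
        using N.a_closed[OF that] by (simp add: ideal_module_def)
      show "r \<odot>\<^bsub>ideal_module R I\<^esub> x \<in> N" if "r \<in> carrier R" "x \<in> N" for r x
        using N.I_l_closed[of x r] that by (simp add: ideal_module_def)
    qed
  qed
qed

lemma module_mu_ideal_module:
  assumes "cring R" "ideal I R"
  shows "module_mu R (ideal_module R I) =
           Inf {enat (card B) | B. finite B \<and> B \<subseteq> I \<and> genideal R B = I}"
proof -
  interpret cring R by fact
  have "\<Inter>{N. submodule N R (ideal_module R I) \<and> B \<subseteq> N} = genideal R B" if "B \<subseteq> I" for B
    unfolding submodule_ideal_module_iff[OF assms] genideal_def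
    using that assms(2) i_intersect by blast
  hence "(\<lambda>B. finite B \<and> B \<subseteq> carrier (ideal_module R I) \<and>
            \<Inter>{N. submodule N R (ideal_module R I) \<and> B \<subseteq> N} = carrier (ideal_module R I)) =
         (\<lambda>B. finite B \<and> B \<subseteq> I \<and> genideal R B = I)"
    by (intro ext) (auto simp: ideal_module_def)
  thus ?thesis unfolding module_mu_def by metis
qed

end

theory Submission
  imports Defs
begin

text \<open>
  Since the \<open>a\<^sub>i\<close> are coprime, \<open>H\<close> contains all \<open>m \<ge> n\<close> for some \<open>n\<close>, i.e. \<open>t\<^sup>n k[t] \<subseteq> R\<close>. If the
  elements of a maximal ideal \<open>M\<close> had no common root, then \<open>M k[t] = k[t]\<close>, so \<open>t\<^sup>n k[t] \<subseteq> M\<close>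
  and hence \<open>P\<^sub>0 \<subseteq> M\<close>, which is absurd. So \<open>M\<close> consists of the elements of \<open>R\<close> vanishing at
  some \<open>c\<close>, and \<open>M = P\<^sub>0\<close> iff \<open>c = 0\<close>.

  For \<open>c \<noteq> 0\<close>, the elements \<open>f = t\<^sup>n - c\<^sup>n\<close> and \<open>g = t\<^bsup>n+1\<^esup> - c\<^bsup>n+1\<^esup>\<close> generate \<open>M\<close>: from
  \<open>g - t f = c\<^sup>n (t - c)\<close> one gets \<open>t\<^sup>n M \<subseteq> (f, g)\<close>, and \<open>t\<^sup>n\<close> is congruent to the unit \<open>c\<^sup>n\<close>
  modulo \<open>f\<close>. One generator is not enough, since it would be a multiple of \<open>t - c\<close> by a
  constant and \<open>1 \<notin> H\<close>. For \<open>c = 0\<close>, both numbers are the number of atoms of \<open>H\<close>, as the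
  monomials of the atoms form a basis of \<open>P\<^sub>0 / P\<^sub>0\<^sup>2\<close>.
\<close>

section \<open>Submonoids of the natural numbers\<close>

text \<open>The irreducible elements of \<open>H\<close>. They form its least generating set, and
  their number is the common value of both invariants at the origin.\<close>

definition atoms :: "nat set \<Rightarrow> nat set" where
  "atoms H = {h \<in> H. h \<noteq> 0 \<and> (\<forall>x\<in>H. \<forall>y\<in>H. x + y = h \<longrightarrow> x = 0 \<or> y = 0)}"

lemma atomsD:
  assumes "h \<in> atoms H" "x \<in> H" "y \<in> H" "x + y = h"
  shows "x = 0 \<or> y = 0"
  using assms by (simp add: atoms_def)

locale nat_submonoid =
  fixes H :: "nat set"
  assumes zero_mem: "0 \<in> H"
    and add_mem: "x \<in> H \<Longrightarrow> y \<in> H \<Longrightarrow> x + y \<in> H"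
begin

lemma mult_mem: "x \<in> H \<Longrightarrow> n * x \<in> H"
  by (induction n) (auto intro: zero_mem add_mem)

lemma num_semigroup_subset:
  assumes "b ` {1..n} \<subseteq> H"
  shows "num_semigroup b n \<subseteq> H"
proof -
  have "(\<Sum>i\<in>I. c i * b i) \<in> H" if "finite I" "I \<subseteq> {1..n}" for c I
    using that assms by (induction I) (auto intro!: zero_mem add_mem mult_mem)
  thus ?thesis by (auto simp: num_semigroup_def)
qed

text \<open>Bezout coefficients may be negative, so the gcd is reached only as a difference of two
  elements of \<open>H\<close>. For gcd 1 these two are consecutive, which is what
  \<open>ex_conductor\<close> asks for.\<close>

lemma ex_diff_eq_Gcd:
  assumes "finite A" "A \<subseteq> H" "0 \<notin> A"
  shows "\<exists>x\<in>H. \<exists>y\<in>H. x = y + Gcd A"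
  using assms
proof (induction A)
  case empty
  thus ?case using zero_mem by force
next
  case (insert a A)
  then obtain x y where xy: "x \<in> H" "y \<in> H" "x = y + Gcd A" by auto
  obtain u w where uw: "a * u = Gcd A * w + gcd a (Gcd A)"
    using bezout_nat[of a "Gcd A"] insert.prems by auto
  have "u * a + w * y = w * x + Gcd (insert a A)"
    using uw xy(3) by (simp add: algebra_simps)
  moreover have "u * a + w * y \<in> H" "w * x \<in> H"
    using xy insert.prems by (auto intro!: add_mem mult_mem)
  ultimately show ?case by blast
qed

text \<open>Division by \<open>x\<close> gives \<open>m = q * x + r\<close> with
  \<open>r < x\<close>. From \<open>x * x\<close> on, also \<open>x \<le> q\<close>, so
  \<open>r\<close> of the \<open>q\<close> copies of \<open>x\<close> can be traded for
  \<open>Suc x\<close> to absorb the remainder.\<close>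

lemma ex_conductor:
  assumes "x \<in> H" "Suc x \<in> H"
  shows "\<exists>n. \<forall>m\<ge>n. m \<in> H"
proof (intro exI allI impI)
  fix m assume m: "m \<ge> x * x"
  show "m \<in> H"
  proof (cases "x = 0")
    case True
    thus ?thesis using mult_mem[OF assms(2), of m] by simp
  next
    case False
    define q r where "q = m div x" and "r = m mod x"
    have "r < x" using False by (simp add: r_def)
    moreover have "x \<le> q" using div_le_mono[OF m, of x] False by (simp add: q_def)
    ultimately have "r \<le> q" by simp
    hence "(q - r) * x + r * Suc x = q * x + r"
      by (simp add: diff_mult_distrib mult_le_mono1)
    also have "\<dots> = m" by (simp add: q_def r_def)
    finally show ?thesis
      using add_mem[OF mult_mem[OF assms(1), of "q - r"] mult_mem[OF assms(2), of r]] by simp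
  qed
qed

text \<open>One generator split off from a representation of an atom leaves a summand in
  \<open>H\<close>, which irreducibility forces to be 0.\<close>

lemma atoms_subset_generators:
  assumes "H = num_semigroup b n"
  shows "atoms H \<subseteq> b ` {1..n}"
proof
  fix h assume h: "h \<in> atoms H"
  then obtain c where c: "h = (\<Sum>i=1..n. c i * b i)"
    using assms by (auto simp: atoms_def num_semigroup_def)
  have "h \<noteq> 0" using h by (simp add: atoms_def)
  then obtain j where j: "j \<in> {1..n}" "c j * b j \<noteq> 0"
    unfolding c by (rule sum.not_neutral_contains_not_neutral)
  \<comment> \<open>One copy of \<open>b j\<close> is removed; the truncated subtraction is exact
    because \<open>c j * b j \<noteq> 0\<close>.\<close>
  define d where "d = c(j := c j - 1)"
  have "h = c j * b j + (\<Sum>i\<in>{1..n}-{j}. c i * b i)"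
    using c j by (simp add: sum.remove)
  also have "(\<Sum>i\<in>{1..n}-{j}. c i * b i) = (\<Sum>i\<in>{1..n}-{j}. d i * b i)"
    by (rule sum.cong) (auto simp: d_def)
  also have "c j * b j = b j + d j * b j"
    using j by (cases "c j") (auto simp: d_def)
  finally have eq: "b j + (\<Sum>i=1..n. d i * b i) = h"
    using j by (simp add: sum.remove)
  have "b j \<in> H" using num_semigroup_gen[OF j(1)] assms by simp
  moreover have "(\<Sum>i=1..n. d i * b i) \<in> H" using assms by (auto simp: num_semigroup_def)
  ultimately have "b j = 0 \<or> (\<Sum>i=1..n. d i * b i) = 0"
    using atomsD[OF h _ _ eq] by simp
  hence "b j = h" using j eq by auto
  thus "h \<in> b ` {1..n}" using j by blast
qed

text \<open>Strong induction: a nonzero element that is not an atom is a sum of two strictly smaller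
  elements of \<open>H\<close>.\<close>

lemma num_semigroup_atoms:
  assumes "b ` {1..n} = atoms H"
  shows "num_semigroup b n = H"
proof
  show "num_semigroup b n \<subseteq> H"
    by (rule num_semigroup_subset) (use assms in \<open>auto simp: atoms_def\<close>)
  have "h \<in> num_semigroup b n" if "h \<in> H" for h
    using that
  proof (induction h rule: less_induct)
    case (less h)
    consider "h = 0" | "h \<in> atoms H" | x y where "x \<in> H" "y \<in> H" "x + y = h" "x \<noteq> 0" "y \<noteq> 0"
      using less.prems by (auto simp: atoms_def)
    thus ?case
    proof cases
      case 1
      thus ?thesis by (simp add: num_semigroup_zero)
    next
      case 2
      with assms obtain i where "i \<in> {1..n}" "h = b i" by blast
      thus ?thesis by (simp add: num_semigroup_gen)
    next
      case 3
      hence "x \<in> num_semigroup b n" "y \<in> num_semigroup b n" using less.IH by auto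
      thus ?thesis unfolding 3(3)[symmetric] by (rule num_semigroup_add)
    qed
  qed
  thus "H \<subseteq> num_semigroup b n" by blast
qed

lemma semigroup_mu_eq_card_atoms:
  assumes "finite (atoms H)"
  shows "semigroup_mu H = enat (card (atoms H))"
  unfolding semigroup_mu_def
proof (rule antisym)
  obtain b where b: "bij_betw b {1..card (atoms H)} (atoms H)"
    using ex_bij_betw_nat_finite_1[OF assms] by blast
  have "H = num_semigroup b (card (atoms H))"
    by (rule num_semigroup_atoms[OF bij_betw_imp_surj_on[OF b], symmetric])
  hence "\<exists>b. H = num_semigroup b (card (atoms H))" by (rule exI[of _ b])
  thus "Inf {enat n |n. \<exists>b. H = num_semigroup b n} \<le> enat (card (atoms H))"
    by (intro Inf_lower CollectI exI[of _ "card (atoms H)"] conjI refl)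
  show "enat (card (atoms H)) \<le> Inf {enat n |n. \<exists>b. H = num_semigroup b n}"
  proof (rule Inf_greatest)
    fix m assume "m \<in> {enat n |n. \<exists>b. H = num_semigroup b n}"
    then obtain n b where m: "m = enat n" and H: "H = num_semigroup b n"
      by (elim CollectE exE conjE)
    have "card (atoms H) \<le> card (b ` {1..n})"
      by (rule card_mono[OF _ atoms_subset_generators[OF H]]) simp
    also have "\<dots> \<le> n" using card_image_le[of "{1..n}" b] by simp
    finally show "enat (card (atoms H)) \<le> m" by (simp add: m)
  qed
qed

end

section \<open>Ideals of semigroup rings\<close>

definition vanishing_ideal :: "nat set \<Rightarrow> 'k::field \<Rightarrow> 'k poly set" where
  "vanishing_ideal H c = {p \<in> carrier (semigroup_ring H). poly p c = 0}"

context nat_submonoid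
begin

abbreviation R :: "'k::field poly ring" where "R \<equiv> semigroup_ring H"

lemma cring_R: "cring R"
  by (rule cring_semigroup_ring) (fact zero_mem add_mem)+

lemma mem_R_iff: "p \<in> carrier R \<longleftrightarrow> (\<forall>n. poly.coeff p n \<noteq> 0 \<longrightarrow> n \<in> H)"
  by (simp add: semigroup_ring_simps)

lemma const_mem_R: "[:x:] \<in> carrier R"
  using zero_mem by (auto simp: mem_R_iff coeff_pCons split: nat.splits)

lemma monom_mem_R: "n \<in> H \<Longrightarrow> monom x n \<in> carrier R"
  by (auto simp: mem_R_iff split: if_splits)

lemma add_mem_R: "p \<in> carrier R \<Longrightarrow> q \<in> carrier R \<Longrightarrow> p + q \<in> carrier R"
  using cring.cring_simprules(1)[OF cring_R] by (simp add: semigroup_ring_simps(5))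

lemma mult_mem_R: "p \<in> carrier R \<Longrightarrow> q \<in> carrier R \<Longrightarrow> p * q \<in> carrier R"
  using cring.cring_simprules(5)[OF cring_R] by (simp add: semigroup_ring_simps(2))

lemma power_mem_R: "p \<in> carrier R \<Longrightarrow> p ^ n \<in> carrier R"
  using const_mem_R[of 1] by (induction n) (auto intro: mult_mem_R simp flip: one_pCons)

lemma diff_mem_R: "p \<in> carrier R \<Longrightarrow> q \<in> carrier R \<Longrightarrow> p - q \<in> carrier R"
  using add_mem_R[of p "[:-1:] * q"] mult_mem_R[OF const_mem_R[of "-1"], of q] by simp

text \<open>Closure under negation comes for free from scaling by the constant \<open>-1\<close>.
  This form replaces the record operations by polynomial arithmetic.\<close>

lemma ideal_R_iff:
  "ideal I R \<longleftrightarrow> I \<subseteq> carrier R \<and> 0 \<in> I \<and> (\<forall>p\<in>I. \<forall>q\<in>I. p + q \<in> I) \<and>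
     (\<forall>p\<in>I. \<forall>r\<in>carrier R. r * p \<in> I)" (is "_ \<longleftrightarrow> ?rhs")
proof
  assume "ideal I R"
  then interpret ideal I R .
  show ?rhs
    using a_subset additive_subgroup.zero_closed[OF is_additive_subgroup]
      additive_subgroup.a_closed[OF is_additive_subgroup] I_l_closed
    by (simp add: semigroup_ring_simps(2-5))
next
  assume rhs: ?rhs
  interpret R: cring R by (rule cring_R)
  show "ideal I R"
  proof (rule idealI)
    show "ring R" by unfold_locales
    show "subgroup I (add_monoid R)"
    proof (rule R.add.subgroupI)
      fix p assume p: "p \<in> I"
      hence "[:-1:] * p \<in> I" using rhs const_mem_R by blast
      hence "- p \<in> I" by simp
      moreover have "\<ominus>\<^bsub>R\<^esub> p = - p"
        using p \<open>- p \<in> I\<close> rhs by (intro R.minus_equality) (auto simp: semigroup_ring_simps(4,5))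
      ultimately show "\<ominus>\<^bsub>R\<^esub> p \<in> I" by simp
    qed (use rhs in \<open>auto simp: semigroup_ring_simps(5)\<close>)
  qed (use rhs in \<open>auto simp: semigroup_ring_simps(2) mult.commute\<close>)
qed

lemma ideal_R_diff:
  assumes "ideal I R" "p \<in> I" "q \<in> I"
  shows "p - q \<in> I"
proof -
  have "p + [:-1:] * q \<in> I" using assms const_mem_R unfolding ideal_R_iff by blast
  thus ?thesis by simp
qed

lemma vanishing_ideal_ideal: "ideal (vanishing_ideal H c) R"
  using const_mem_R[of 0] by (auto simp: ideal_R_iff vanishing_ideal_def intro: add_mem_R mult_mem_R)

lemma one_notin_vanishing_ideal: "1 \<notin> vanishing_ideal H c"
  by (simp add: vanishing_ideal_def)

lemma one_mem_R: "1 \<in> carrier R"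
  using const_mem_R[of 1] by (simp flip: one_pCons)

end

section \<open>Maximal ideals as points of the affine line\<close>

text \<open>By Euclidean division a nonzero element of least degree divides all of \<open>J\<close>.
  A root of it would be common to \<open>J\<close>, so it is a nonzero constant.\<close>

lemma poly_ideal_without_common_root:
  fixes J :: "'k::alg_closed_field poly set"
  assumes zero: "0 \<in> J" and add: "\<And>p q. p \<in> J \<Longrightarrow> q \<in> J \<Longrightarrow> p + q \<in> J"
    and mult: "\<And>p q. p \<in> J \<Longrightarrow> q * p \<in> J"
    and root: "\<And>c. \<exists>p\<in>J. poly p c \<noteq> 0"
  shows "1 \<in> J"
proof -
  obtain p where p: "p \<in> J" "p \<noteq> 0" using root[of 0] by (metis poly_0)
  define g where "g = arg_min degree (\<lambda>p. p \<in> J \<and> p \<noteq> 0)"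
  have g: "g \<in> J" "g \<noteq> 0" and min: "\<And>q. q \<in> J \<Longrightarrow> q \<noteq> 0 \<Longrightarrow> degree g \<le> degree q"
    using arg_min_natI[of "\<lambda>p. p \<in> J \<and> p \<noteq> 0" p degree] 
      arg_min_nat_le[of "\<lambda>p. p \<in> J \<and> p \<noteq> 0" _ degree] p
    unfolding g_def by auto
  have dvd: "g dvd q" if "q \<in> J" for q
  proof -
    have "q + (- (q div g)) * g \<in> J" using that g(1) by (intro add mult)
    hence "q mod g \<in> J" by (simp add: minus_div_mult_eq_mod)
    hence "q mod g = 0" using min[of "q mod g"] degree_mod_less[OF g(2), of q] by force
    thus ?thesis by (simp add: dvd_eq_mod_eq_0)
  qed
  have "degree g = 0"
  proof (rule ccontr)
    assume "degree g \<noteq> 0"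
    then obtain c where "poly g c = 0" using alg_closed_imp_poly_has_root[of g] by auto
    moreover obtain q where "q \<in> J" "poly q c \<noteq> 0" using root by blast
    ultimately show False using dvd[of q] by (auto elim!: dvdE)
  qed
  then obtain x where "g = [:x:]" by (metis degree_eq_zeroE)
  hence "[:inverse x:] * g = 1" using g(2) by (simp flip: one_pCons)
  thus ?thesis using mult[OF g(1), of "[:inverse x:]"] by simp
qed

context nat_submonoid
begin

lemma maximalideal_eq_vanishing_ideal:
  fixes M :: "'k::alg_closed_field poly set"
  assumes M: "maximalideal M R" and n: "\<forall>m\<ge>n. m \<in> H"
  shows "\<exists>c. M = vanishing_ideal H c"
proof -
  interpret M: maximalideal M "R :: 'k poly ring" by (rule M)
  have ideal: "ideal M R" by unfold_locales
  have sub: "M \<subseteq> carrier R" and add: "\<And>p q. p \<in> M \<Longrightarrow> q \<in> M \<Longrightarrow> p + q \<in> M"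
    and mult: "\<And>p r. p \<in> M \<Longrightarrow> r \<in> carrier R \<Longrightarrow> r * p \<in> M" and zero: "0 \<in> M"
    using ideal unfolding ideal_R_iff by blast+
  have one: "1 \<notin> M"
  proof
    assume "1 \<in> M"
    hence "carrier R \<subseteq> M" using mult[of 1] by auto
    thus False using M.I_notcarr sub by blast
  qed
  have "\<exists>c. M \<subseteq> vanishing_ideal H c"
  proof (rule ccontr)
    assume "\<nexists>c. M \<subseteq> vanishing_ideal H c"
    hence no_root: "\<exists>p\<in>M. poly p c \<noteq> 0" for c
      using sub by (auto simp: vanishing_ideal_def)
    \<comment> \<open>The elements multiplying the conductor ideal of \<open>k[t]\<close> into \<open>M\<close>: an ideal of \<open>k[t]\<close>
      containing \<open>M\<close>, hence everything, so that \<open>M\<close> contains the conductor.\<close>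
    define J where "J = {s. \<forall>q. s * (monom 1 n * q) \<in> M}"
    have cond: "monom 1 n * q \<in> carrier R" for q :: "'k poly"
      using n by (auto simp: mem_R_iff coeff_monom_mult split: if_splits)
    have MJ: "M \<subseteq> J"
      using mult[OF _ cond] by (auto simp: J_def mult.commute)
    have "1 \<in> J"
    proof (rule poly_ideal_without_common_root)
      fix p q assume "p \<in> J"
      thus "q * p \<in> J" by (auto simp: J_def) (metis mult.assoc mult.left_commute)
    next
      show "\<exists>p\<in>J. poly p c \<noteq> 0" for c using no_root MJ by blast
    qed (use zero add in \<open>auto simp: J_def distrib_right\<close>)
    \<comment> \<open>The conductor supplies only the \<open>n\<close>-th power of an element
      vanishing at 0; primality brings the element itself into \<open>M\<close>.\<close>
    have prime: "primeideal M R"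
      by (rule cring.maximalideal_prime[OF cring_R M])
    have root_mem: "p \<in> M" if "p \<in> carrier R" "p ^ m \<in> M" for p m
      using that(2)
    proof (induction m)
      case (Suc m)
      thus ?case using primeideal.I_prime[OF prime that(1) power_mem_R[OF that(1), of m]]
        by (auto simp: semigroup_ring_simps(2))
    qed (use one in auto)
    have V: "vanishing_ideal H 0 \<subseteq> M"
    proof
      fix p :: "'k poly" assume p: "p \<in> vanishing_ideal H 0"
      then obtain q where "p = monom 1 1 * q"
        using poly_eq_0_iff_dvd[of p 0] by (auto simp: vanishing_ideal_def monom_Suc monom_0 elim!: dvdE)
      hence "p ^ n = 1 * (monom 1 n * q ^ n)" by (simp add: power_mult_distrib monom_power)
      also have "\<dots> \<in> M" using \<open>1 \<in> J\<close> unfolding J_def by blast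
      finally show "p \<in> M" using root_mem p by (auto simp: vanishing_ideal_def)
    qed
    \<comment> \<open>Subtracting from \<open>p\<close> its part without constant term, which lies
      in \<open>M\<close> by \<open>V\<close>, leaves a nonzero constant in
      \<open>M\<close>.\<close>
    obtain p where p: "p \<in> M" "poly p 0 \<noteq> 0" using no_root by blast
    define x where "x = poly p 0"
    have "p - [:x:] \<in> M"
      using p sub by (intro subsetD[OF V]) (auto simp: vanishing_ideal_def x_def intro!: diff_mem_R const_mem_R)
    from ideal_R_diff[OF ideal p(1) this] have "[:inverse x:] * [:x:] \<in> M"
      by (intro mult const_mem_R) simp
    thus False using one p(2) by (simp add: x_def flip: one_pCons)
  qed
  then obtain c where c: "M \<subseteq> vanishing_ideal H c" by blast
  have "vanishing_ideal H c = M \<or> vanishing_ideal H c = carrier R"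
    by (rule M.I_maximal) (use c vanishing_ideal_ideal in \<open>auto simp: vanishing_ideal_def\<close>)
  thus ?thesis using one_notin_vanishing_ideal[of c] one_mem_R c by auto
qed

lemma genideal_subset_ideal:
  assumes "ideal I R" "B \<subseteq> I"
  shows "genideal R B \<subseteq> I"
  using ring.genideal_minimal[OF cring.axioms(1)[OF cring_R] assms] .

lemma genideal_is_ideal:
  assumes "B \<subseteq> carrier R"
  shows "ideal (genideal R B) R" "B \<subseteq> genideal R B"
  using ring.genideal_ideal[OF cring.axioms(1)[OF cring_R] assms]
    ring.genideal_self[OF cring.axioms(1)[OF cring_R] assms] by auto

lemma module_mu_vanishing_ideal:
  "module_mu R (ideal_module R (vanishing_ideal H c)) =
     Inf {enat (card B) |B. finite B \<and> B \<subseteq> vanishing_ideal H c \<and> genideal R B = vanishing_ideal H c}"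
  by (rule module_mu_ideal_module[OF cring_R vanishing_ideal_ideal])

section \<open>The maximal ideals away from the origin\<close>

text \<open>An identity of \<open>k[t]\<close>: the factor \<open>monom 1 1\<close> need not lie in
  \<open>R\<close>.\<close>

lemma two_generators_identity:
  fixes c :: "'k::field"
  shows "(monom 1 (Suc n) - [:c ^ Suc n:]) - monom 1 1 * (monom 1 n - [:c ^ n:])
           = [:c ^ n:] * [:-c, 1:]"
  by (rule poly_eqI) (auto simp: coeff_pCons monom_Suc monom_0 split: nat.splits)

lemma genideal_two_generators:
  fixes c :: "'k::field"
  assumes c: "c \<noteq> 0" and n: "\<forall>m\<ge>n. m \<in> H"
  shows "genideal R {monom 1 n - [:c ^ n:], monom 1 (Suc n) - [:c ^ Suc n:]} = vanishing_ideal H c"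
proof -
  define f g where "f = monom 1 n - [:c ^ n:]" and "g = monom 1 (Suc n) - [:c ^ Suc n:]"
  have f: "f \<in> carrier R" and g: "g \<in> carrier R"
    unfolding f_def g_def by (intro diff_mem_R monom_mem_R const_mem_R; use n in simp)+
  have fV: "{f, g} \<subseteq> vanishing_ideal H c"
    using f g by (auto simp: vanishing_ideal_def f_def g_def poly_monom)
  let ?I = "genideal R {f, g}"
  have ideal: "ideal ?I R" and fg: "f \<in> ?I" "g \<in> ?I"
    using genideal_is_ideal[of "{f, g}"] f g by auto
  have mult: "\<And>p r. p \<in> ?I \<Longrightarrow> r \<in> carrier R \<Longrightarrow> r * p \<in> ?I"
    using ideal unfolding ideal_R_iff by blast
  have cond: "monom 1 n * q \<in> carrier R" for q :: "'k poly"
    using n by (auto simp: mem_R_iff coeff_monom_mult split: if_splits)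
  have "vanishing_ideal H c \<subseteq> ?I"
  proof
    fix h assume h: "h \<in> vanishing_ideal H c"
    then obtain s where s: "h = [:-c, 1:] * s"
      by (auto simp: vanishing_ideal_def poly_eq_0_iff_dvd elim!: dvdE)
    have "[:c ^ n:] * [:-c, 1:] = g - monom 1 1 * f"
      using two_generators_identity[of n c] by (simp add: f_def g_def)
    hence cnh: "[:c ^ n:] * h = (g - monom 1 1 * f) * s"
      unfolding s by (metis mult.assoc)
    have tn: "monom 1 n = f + [:c ^ n:]" by (simp add: f_def)
    \<comment> \<open>The cofactor \<open>s\<close> need not lie in \<open>R\<close>. Trading one
      constant \<open>c ^ n\<close> for \<open>monom 1 n - f\<close> puts a factor
      \<open>monom 1 n\<close> in front of \<open>s\<close>, so that all coefficients of
      \<open>f\<close> and \<open>g\<close> lie in \<open>R\<close>.\<close>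
    have "[:c ^ n:] * ([:c ^ n:] * h) = monom 1 n * ([:c ^ n:] * h) - ([:c ^ n:] * h) * f"
      unfolding tn by (simp add: algebra_simps)
    also have "\<dots> = (monom 1 n * s) * g - (monom 1 n * (monom 1 1 * s)) * f - ([:c ^ n:] * h) * f"
      unfolding cnh by (simp only: algebra_simps)
    also have "\<dots> \<in> ?I"
      using h by (intro ideal_R_diff[OF ideal] mult fg cond mult_mem_R const_mem_R)
        (auto simp: vanishing_ideal_def)
    finally have "[:inverse (c ^ n * c ^ n):] * ([:c ^ n:] * ([:c ^ n:] * h)) \<in> ?I"
      by (rule mult) (rule const_mem_R)
    moreover have "[:inverse (c ^ n * c ^ n):] * ([:c ^ n:] * ([:c ^ n:] * h)) = h"
      using c by (simp add: field_simps)
    ultimately show "h \<in> ?I" by simp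
  qed
  moreover have "?I \<subseteq> vanishing_ideal H c"
    by (rule genideal_subset_ideal[OF vanishing_ideal_ideal fV])
  ultimately show ?thesis by (simp add: f_def g_def)
qed

lemma vanishing_ideal_not_principal:
  fixes c :: "'k::field"
  assumes c: "c \<noteq> 0" and n: "\<forall>m\<ge>n. m \<in> H" and one: "1 \<notin> H"
    and p: "p \<in> vanishing_ideal H c"
  shows "genideal R {p} \<noteq> vanishing_ideal H c"
proof
  assume gen: "genideal R {p} = vanishing_ideal H c"
  \<comment> \<open>Divisibility is meant in \<open>k[t]\<close>, where the identity for the two
    generators can be applied.\<close>
  have "ideal {q \<in> carrier R. p dvd q} R"
    using const_mem_R[of 0] by (auto simp: ideal_R_iff intro: add_mem_R mult_mem_R)
  hence "vanishing_ideal H c \<subseteq> {q \<in> carrier R. p dvd q}"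
    unfolding gen[symmetric] by (rule genideal_subset_ideal) (use p in \<open>auto simp: vanishing_ideal_def\<close>)
  moreover have "{monom 1 n - [:c ^ n:], monom 1 (Suc n) - [:c ^ Suc n:]} \<subseteq> vanishing_ideal H c"
    unfolding genideal_two_generators[OF c n, symmetric]
    by (intro genideal_is_ideal(2)) (use n in \<open>auto intro!: diff_mem_R monom_mem_R const_mem_R\<close>)
  ultimately have "p dvd monom 1 n - [:c ^ n:]" "p dvd monom 1 (Suc n) - [:c ^ Suc n:]"
    by auto
  hence "p dvd [:c ^ n:] * [:-c, 1:]"
    unfolding two_generators_identity[symmetric] by (metis dvd_diff dvd_mult)
  hence "p dvd smult (c ^ n) [:-c, 1:]" by (simp add: mult.commute)
  hence pdvd: "p dvd [:-c, 1:]" using c by (metis dvd_smult_cancel power_not_zero)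
  have "[:-c, 1:] dvd p" using p by (simp add: vanishing_ideal_def poly_eq_0_iff_dvd)
  then obtain s where s: "p = [:-c, 1:] * s" by (auto elim!: dvdE)
  have "p \<noteq> 0" using pdvd by auto
  hence "s \<noteq> 0" using s by auto
  have "degree p \<le> 1" using dvd_imp_degree_le[OF pdvd] by simp
  moreover have "degree p = degree [:-c, 1:] + degree s"
    unfolding s by (rule degree_mult_eq) (use \<open>s \<noteq> 0\<close> in auto)
  ultimately have "degree s = 0" by simp
  then obtain x where "s = [:x:]" by (metis degree_eq_zeroE)
  \<comment> \<open>Here \<open>p\<close> is a nonzero constant times \<open>t - c\<close>, so its
    linear term would put 1 into \<open>H\<close>.\<close>
  hence "poly.coeff p 1 \<noteq> 0" using \<open>s \<noteq> 0\<close> s by simp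
  thus False using p one by (auto simp: vanishing_ideal_def mem_R_iff)
qed

lemma module_mu_vanishing_ideal_nonzero:
  fixes c :: "'k::field"
  assumes c: "c \<noteq> 0" and n: "\<forall>m\<ge>n. m \<in> H" and one: "1 \<notin> H"
  shows "module_mu R (ideal_module R (vanishing_ideal H c)) = 2"
  unfolding module_mu_vanishing_ideal
proof (rule antisym)
  let ?V = "vanishing_ideal H c"
  let ?B = "{monom 1 n - [:c ^ n:], monom 1 (Suc n) - [:c ^ Suc n:]}"
  have "?B \<subseteq> ?V"
    unfolding genideal_two_generators[OF c n, symmetric]
    by (intro genideal_is_ideal(2)) (use n in \<open>auto intro!: diff_mem_R monom_mem_R const_mem_R\<close>)
  hence "Inf {enat (card B) |B. finite B \<and> B \<subseteq> ?V \<and> genideal R B = ?V} \<le> enat (card ?B)"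
    using genideal_two_generators[OF c n] by (intro Inf_lower) blast
  also have "\<dots> \<le> enat 2" using card_2_iff' card_insert_le_m1[of 2 "{monom 1 (Suc n) - [:c ^ Suc n:]}"] by simp
  finally show "Inf {enat (card B) |B. finite B \<and> B \<subseteq> ?V \<and> genideal R B = ?V} \<le> 2"
    by (simp add: numeral_eq_enat)
  show "2 \<le> Inf {enat (card B) |B. finite B \<and> B \<subseteq> ?V \<and> genideal R B = ?V}"
  proof (rule Inf_greatest, clarify)
    fix B assume B: "finite B" "B \<subseteq> ?V" "genideal R B = ?V"
    have "2 \<le> card B"
    proof (rule ccontr)
      assume "\<not> 2 \<le> card B"
      \<comment> \<open>An empty generating set can be replaced by \<open>{0}\<close>.\<close>
      then obtain p where p: "p \<in> ?V" "B \<subseteq> {p}"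
      proof (cases "B = {}")
        case True
        moreover have "0 \<in> ?V" using vanishing_ideal_ideal[of c] unfolding ideal_R_iff by blast
        ultimately show thesis using that by blast
      next
        case False
        hence "card B = 1" using \<open>\<not> 2 \<le> card B\<close> B(1) card_gt_0_iff[of B] by linarith
        then obtain q where "B = {q}" by (rule card_1_singletonE)
        thus thesis using that[of q] B(2) by simp
      qed
      hence "genideal R B \<subseteq> genideal R {p}"
        using genideal_is_ideal[of "{p}"] by (intro genideal_subset_ideal) (auto simp: vanishing_ideal_def)
      moreover have "genideal R {p} \<subseteq> ?V"
        using p by (intro genideal_subset_ideal vanishing_ideal_ideal) auto
      ultimately show False
        using B vanishing_ideal_not_principal[OF c n one p(1)] by simp
    qed
    thus "2 \<le> enat (card B)" by (simp add: numeral_eq_enat)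
  qed
qed

section \<open>The maximal ideal at the origin\<close>

text \<open>Stated for any positive generating system, since it serves both the given
  \<open>a\<close> (for \<open>P0\<close>) and an enumeration of the atoms.\<close>

lemma genideal_monoms_eq_vanishing_ideal:
  assumes H: "H = num_semigroup a v" and pos: "\<And>i. i \<in> {1..v} \<Longrightarrow> 0 < a i"
  shows "genideal R ((\<lambda>i. monom (1::'k::field) (a i)) ` {1..v}) = vanishing_ideal H 0"
proof -
  have "(\<exists>q. p = q * monom 1 1) \<longleftrightarrow> poly p 0 = 0" for p :: "'k poly"
    using poly_eq_0_iff_dvd[of p 0] by (auto simp: monom_Suc monom_0 dvd_def mult.commute)
  hence "cgenideal ring_of_type_algebra (monom (1::'k) 1) = {p. poly p 0 = 0}"
    unfolding cgenideal_def by (auto simp: ring_of_type_algebra_def)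
  thus ?thesis using genideal_monoms_eq[OF pos, where 'k = 'k]
    unfolding H vanishing_ideal_def by auto
qed

text \<open>\<open>R\<close> acts on the quotient through constant terms, so the images of ideal
  generators already span it over \<open>k\<close>.\<close>

lemma card_atoms_le_card_generators:
  fixes B :: "'k::field poly set"
  assumes fin: "finite (atoms H)" and B: "finite B" "B \<subseteq> vanishing_ideal H 0"
    and gen: "genideal R B = vanishing_ideal H 0"
  shows "card (atoms H) \<le> card B"
proof -
  interpret vs: vector_space "smult :: 'k \<Rightarrow> 'k poly \<Rightarrow> 'k poly"
    by unfold_locales (auto simp: smult_add_right smult_add_left)
  \<comment> \<open>The projection of \<open>P\<^sub>0\<close> onto \<open>P\<^sub>0 / P\<^sub>0\<^sup>2\<close>, the latter having the monomials of the
    atoms as a basis.\<close>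
  define \<phi> where "\<phi> p = (\<Sum>h\<in>atoms H. monom (poly.coeff p h) h)" for p :: "'k poly"
  have coeff_\<phi>: "poly.coeff (\<phi> p) m = (if m \<in> atoms H then poly.coeff p m else 0)" for p m
    using fin by (simp add: \<phi>_def coeff_sum sum.delta)
  have \<phi>_add: "\<phi> (p + q) = \<phi> p + \<phi> q" for p q
    by (rule poly_eqI) (simp add: coeff_\<phi>)
  \<comment> \<open>At an atom \<open>m\<close> only the term \<open>i = 0\<close> of the
    convolution survives: any other nonzero term would split \<open>m\<close> into two nonzero
    elements of \<open>H\<close>, as \<open>p\<close> has no constant term.\<close>
  have \<phi>_mult: "\<phi> (r * p) = smult (poly.coeff r 0) (\<phi> p)"
    if r: "r \<in> carrier R" and p: "p \<in> vanishing_ideal H 0" for r p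
  proof (rule poly_eqI)
    fix m
    show "poly.coeff (\<phi> (r * p)) m = poly.coeff (smult (poly.coeff r 0) (\<phi> p)) m"
    proof (cases "m \<in> atoms H")
      case True
      have "poly.coeff r i * poly.coeff p (m - i) = 0" if "i \<in> {..m} - {0}" for i
      proof (rule ccontr)
        assume "poly.coeff r i * poly.coeff p (m - i) \<noteq> 0"
        hence nz: "poly.coeff r i \<noteq> 0" "poly.coeff p (m - i) \<noteq> 0" by auto
        hence "i \<in> H" "m - i \<in> H" using r p by (auto simp: mem_R_iff vanishing_ideal_def)
        moreover have "poly.coeff p 0 = 0" using p by (simp add: vanishing_ideal_def poly_0_coeff_0)
        hence "m - i \<noteq> 0" using nz by metis
        moreover have "i + (m - i) = m" "i \<noteq> 0" using that by auto
        ultimately show False using atomsD[OF True, of i "m - i"] by simp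
      qed
      hence "poly.coeff (r * p) m = poly.coeff r 0 * poly.coeff p (m - 0)"
        unfolding coeff_mult by (subst sum.remove[of _ 0]) (simp_all add: sum.neutral del: mult_eq_0_iff)
      thus ?thesis using True by (simp add: coeff_\<phi>)
    qed (simp add: coeff_\<phi>)
  qed
  \<comment> \<open>An ideal containing the generators \<open>B\<close>, hence all of the vanishing
    ideal.\<close>
  have "ideal {p \<in> vanishing_ideal H 0. \<phi> p \<in> vs.span (\<phi> ` B)} R"
    using vanishing_ideal_ideal[of "0::'k"] unfolding ideal_R_iff
    by (auto simp: \<phi>_add \<phi>_mult intro: vs.span_add vs.span_scale)
       (simp add: \<phi>_def vs.span_zero)
  hence "vanishing_ideal H 0 \<subseteq> {p \<in> vanishing_ideal H 0. \<phi> p \<in> vs.span (\<phi> ` B)}"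
    unfolding gen[symmetric]
    by (rule genideal_subset_ideal) (use B gen in \<open>auto intro: vs.span_base\<close>)
  hence span: "\<phi> p \<in> vs.span (\<phi> ` B)" if "p \<in> vanishing_ideal H 0" for p
    using that by blast
  let ?A = "monom (1::'k) ` atoms H"
  have inj: "inj_on (monom (1::'k)) (atoms H)"
    by (rule inj_onI) (metis monom_eq_iff' one_neq_zero)
  have "?A \<subseteq> vs.span (\<phi> ` B)"
  proof clarify
    fix h assume h: "h \<in> atoms H"
    have "\<phi> (monom 1 h) = monom 1 h" by (rule poly_eqI) (use h in \<open>auto simp: coeff_\<phi>\<close>)
    moreover have "monom 1 h \<in> vanishing_ideal H (0::'k)"
      using h by (auto simp: vanishing_ideal_def atoms_def poly_monom intro: monom_mem_R)
    ultimately show "monom 1 h \<in> vs.span (\<phi> ` B)" using span by metis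
  qed
  moreover have "vs.independent ?A"
  proof (rule vs.independent_if_scalars_zero)
    fix f :: "'k poly \<Rightarrow> 'k" and x
    assume sum0: "(\<Sum>x\<in>?A. smult (f x) x) = 0" and "x \<in> ?A"
    then obtain h where h: "h \<in> atoms H" "x = monom 1 h" by blast
    have "(\<Sum>j\<in>atoms H. smult (f (monom 1 j)) (monom 1 j)) = 0"
      using sum0 by (simp add: sum.reindex[OF inj])
    hence "poly.coeff (\<Sum>j\<in>atoms H. monom (f (monom 1 j)) j) h = 0"
      by (simp add: smult_monom)
    thus "f x = 0" using h fin by (simp add: coeff_sum sum.delta)
  qed (use fin in simp)
  ultimately have "card ?A \<le> card (\<phi> ` B)"
    using vs.independent_span_bound[of "\<phi> ` B" ?A] B(1) by blast
  also have "\<dots> \<le> card B" by (rule card_image_le[OF B(1)])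
  finally show ?thesis by (simp add: card_image[OF inj])
qed

text \<open>The monomials of the atoms attain the lower bound just proved.\<close>

lemma module_mu_vanishing_ideal_zero:
  assumes fin: "finite (atoms H)"
  shows "module_mu R (ideal_module R (vanishing_ideal H (0::'k::field))) = enat (card (atoms H))"
  unfolding module_mu_vanishing_ideal
proof (rule antisym)
  let ?V = "vanishing_ideal H (0::'k)"
  obtain b where b: "bij_betw b {1..card (atoms H)} (atoms H)"
    using ex_bij_betw_nat_finite_1[OF fin] by blast
  have b_atom: "b i \<in> atoms H" if "i \<in> {1..card (atoms H)}" for i
    using bij_betwE[OF b] that by blast
  define B where "B = (\<lambda>i. monom (1::'k) (b i)) ` {1..card (atoms H)}"
  have gen: "genideal R B = ?V"
    unfolding B_def
  proof (rule genideal_monoms_eq_vanishing_ideal)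
    show "H = num_semigroup b (card (atoms H))"
      by (rule num_semigroup_atoms[OF bij_betw_imp_surj_on[OF b], symmetric])
    show "0 < b i" if "i \<in> {1..card (atoms H)}" for i
      using b_atom[OF that] unfolding atoms_def by blast
  qed
  have "monom 1 (b i) \<in> (carrier R :: 'k poly set)" if "i \<in> {1..card (atoms H)}" for i
    using b_atom[OF that] unfolding atoms_def by (intro monom_mem_R) blast
  hence "B \<subseteq> carrier R" unfolding B_def by blast
  hence "B \<subseteq> ?V" using genideal_is_ideal(2) gen by metis
  moreover have "finite B" by (simp add: B_def)
  ultimately have "Inf {enat (card B) |B. finite B \<and> B \<subseteq> ?V \<and> genideal R B = ?V} \<le> enat (card B)"
    using gen by (intro Inf_lower CollectI exI[of _ B] conjI refl)
  also have "enat (card B) \<le> enat (card (atoms H))"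
    using card_image_le[of "{1..card (atoms H)}" "\<lambda>i. monom (1::'k) (b i)"] by (simp add: B_def)
  finally show "Inf {enat (card B) |B. finite B \<and> B \<subseteq> ?V \<and> genideal R B = ?V} \<le> enat (card (atoms H))" .
  show "enat (card (atoms H)) \<le> Inf {enat (card B) |B. finite B \<and> B \<subseteq> ?V \<and> genideal R B = ?V}"
  proof (rule Inf_greatest, elim CollectE exE conjE)
    fix m B assume m: "m = enat (card B)" and B: "finite B" "B \<subseteq> ?V" "genideal R B = ?V"
    show "enat (card (atoms H)) \<le> m"
      unfolding m using card_atoms_le_card_generators[OF fin B] by simp
  qed
qed

end

theorem corollary4p5:
  fixes a :: "nat \<Rightarrow> nat" and v :: nat and H :: "nat set"
    and R :: "'k::alg_closed_field poly ring" and P0 M :: "'k poly set"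
  assumes "v > 0"
    and "\<And>i. i \<in> {1..v} \<Longrightarrow> a i > 0"
    and "Gcd (a ` {1..v}) = 1"
    and "H = num_semigroup a v"
    and "1 \<notin> H"
    and "R = semigroup_ring H"
    and "P0 = genideal R ((\<lambda>i. monom 1 (a i)) ` {1..v})"
    and "maximalideal M R"
  shows "(M \<noteq> P0 \<longrightarrow> module_mu R (ideal_module R M) = 2) \<and>
         (M = P0 \<longrightarrow> module_mu R (ideal_module R M) = semigroup_mu H)"
proof -
  interpret nat_submonoid H
    by unfold_locales (auto simp: assms(4) num_semigroup_zero num_semigroup_add)
  have "a ` {1..v} \<subseteq> H" using num_semigroup_gen[of _ v a] assms(4) by auto
  moreover have "0 \<notin> a ` {1..v}" using assms(2) by force
  ultimately obtain x where "x \<in> H" "Suc x \<in> H"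
    using ex_diff_eq_Gcd[of "a ` {1..v}"] assms(3) by auto
  then obtain n where n: "\<forall>m\<ge>n. m \<in> H" using ex_conductor by blast
  have P0: "P0 = vanishing_ideal H 0"
    unfolding assms(6,7) by (rule genideal_monoms_eq_vanishing_ideal[OF assms(4,2)])
  obtain c where c: "M = vanishing_ideal H c"
    using maximalideal_eq_vanishing_ideal[OF assms(8)[unfolded assms(6)] n] by blast
  have fin: "finite (atoms H)"
    by (rule finite_subset[OF atoms_subset_generators[OF assms(4)]]) simp
  show ?thesis
  proof (intro conjI impI)
    assume "M \<noteq> P0"
    hence "c \<noteq> 0" using c P0 by auto
    thus "module_mu R (ideal_module R M) = 2"
      unfolding assms(6) c by (rule module_mu_vanishing_ideal_nonzero[OF _ n assms(5)])
  next
    assume "M = P0"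
    thus "module_mu R (ideal_module R M) = semigroup_mu H"
      unfolding assms(6) P0
      using module_mu_vanishing_ideal_zero[OF fin] semigroup_mu_eq_card_atoms[OF fin] by simp
  qed
qed

end
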